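(* Let $a\in\mathbb{R}$, $\lambda>0$, $\varepsilon>0$ satisfy $\lambda>\varepsilon|a|$, let $T>0$ and $Q_T=\mathbb{R}\times[0,T)$. Let $w_0$ and $\bar w_0$ be initial data for, respectively, the system $$\partial_t u+\partial_x v=0,\qquad \varepsilon^2\partial_t v+\lambda^2\partial_x u=au-v \qquad (\mathrm{H})$$ and the system $$\partial_t\bar u+a\,\partial_x\bar u=\lambda^2\partial_{xx}\bar u,\qquad \bar v=a\bar u-\lambda^2\partial_x\bar u. \qquad (\mathrm{P})$$ Let $w=(u,v)$ be a strong entropy solution of (H) on $Q_T$ with initial data $w_0$ and let $\bar w=(\bar u,\bar v)$ be the smooth solution of (P) on $Q_T$ with initial data $\bar w_0$. Assume that there are constant states $w_\pm\in\mathbb{R}^2$ such that, for all $t\in[0,T)$, $$\lim_{x\to\pm\infty}w(x,t)=\lim_{x\to\pm\infty}\bar w(x,t)=w_\pm .$$ For $t\in[0,T)$ put $$\phi(t)=\int_{\mathbb{R}}\Big[\frac{\lambda^2}{2}(u-\bar u)^2+\frac{\varepsilon^2}{2}(v-\bar v)^2-\varepsilon^2a(u-\bar u)(v-\bar v)\Big](x,t)\,dx .$$ Assume that $\phi(0)<+\infty$ and that there exists $K>0$ such that $\|\partial_t\bar v\|_{L^2(Q_T)}\le K$. Then $$\phi(t)\le\phi(0)+\frac{K^2}{2}\,\varepsilon^4,\qquad t\in[0,T).$$ Moreover, with $a,\lambda,T,K$ fixed (independent of $\varepsilon$) and given such solutions for each small $\varepsilon$, if $\phi(0)\to0$ as $\varepsilon\to0$,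 then $\sup_{t\in[0,T)}\phi(t)\to0$ as $\varepsilon\to0$.
   Context: The unknowns are real-valued functions of $(x,t)$. A strong entropy solution of (H) is a classical ($C^1$) solution which satisfies the entropy inequality $\partial_tE(u,v)+\partial_xF(u,v)\le-(au-v)^2$, where $E(u,v)=\frac{\lambda^2}{2}u^2+\frac{\varepsilon^2}{2}v^2-\varepsilon^2auv$ and $F(u,v)=-\frac{\lambda^2a}{2}u^2-\frac{\varepsilon^2a}{2}v^2+\lambda^2uv$. The condition $\lambda>\varepsilon|a|$ is the subcharacteristic condition, under which $E$ is strictly convex. The integrand of $\phi$ is the relative entropy $E(w|\bar w)=E(w)-E(\bar w)-\nabla E(\bar w)\cdot(w-\bar w)$. *)

theory Defs
  imports "HOL-Analysis.Analysis"
begin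

text \<open>Points of space-time are pairs \<open>(x, t)\<close> and states are pairs \<open>w = (u, v)\<close>.\<close>

definition QT :: "real \<Rightarrow> (real \<times> real) set" where
  "QT T = UNIV \<times> {0..<T}"

definition dx :: "(real \<times> real \<Rightarrow> real) \<Rightarrow> real \<times> real \<Rightarrow> real" where
  "dx f = (\<lambda>(x, t). deriv (\<lambda>y. f (y, t)) x)"

text \<open>Differentiating within \<open>{0..<T}\<close> makes the time derivative one-sided at \<open>t = 0\<close>
  and the usual one for \<open>0 < t < T\<close>; values of \<open>f\<close> outside \<open>QT T\<close> play no role.\<close>

definition dt :: "real \<Rightarrow> (real \<times> real \<Rightarrow> real) \<Rightarrow> real \<times> real \<Rightarrow> real" where
  "dt T f = (\<lambda>(x, t). vector_derivative (\<lambda>s. f (x, s)) (at t within {0..<T}))"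

text \<open>Class \<open>C\<^sup>k\<close> on \<open>QT T\<close>, up to and including the initial line \<open>t = 0\<close>.\<close>

fun C_k :: "real \<Rightarrow> nat \<Rightarrow> (real \<times> real \<Rightarrow> real) \<Rightarrow> bool" where
  "C_k T 0 f \<longleftrightarrow> continuous_on (QT T) f"
| "C_k T (Suc k) f \<longleftrightarrow>
     continuous_on (QT T) f \<and>
     (\<forall>(x, t) \<in> QT T.
        (\<lambda>y. f (y, t)) differentiable (at x) \<and>
        (\<lambda>s. f (x, s)) differentiable (at t within {0..<T})) \<and>
     C_k T k (dx f) \<and> C_k T k (dt T f)"

definition smooth :: "real \<Rightarrow> (real \<times> real \<Rightarrow> real) \<Rightarrow> bool" where
  "smooth T f \<longleftrightarrow> (\<forall>k. C_k T k f)"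

definition entropy :: "real \<Rightarrow> real \<Rightarrow> real \<Rightarrow> real \<times> real \<Rightarrow> real" where
  "entropy a lam eps = (\<lambda>(u, v).
     lam\<^sup>2 / 2 * u\<^sup>2 + eps\<^sup>2 / 2 * v\<^sup>2 - eps\<^sup>2 * a * u * v)"

definition entropy_flux :: "real \<Rightarrow> real \<Rightarrow> real \<Rightarrow> real \<times> real \<Rightarrow> real" where
  "entropy_flux a lam eps = (\<lambda>(u, v).
     - (lam\<^sup>2 * a / 2) * u\<^sup>2 - eps\<^sup>2 * a / 2 * v\<^sup>2 + lam\<^sup>2 * u * v)"

definition strong_entropy_solution_H ::
  "real \<Rightarrow> real \<Rightarrow> real \<Rightarrow> real \<Rightarrow> (real \<Rightarrow> real \<times> real) \<Rightarrow> (real \<times> real \<Rightarrow> real \<times> real) \<Rightarrow> bool"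
where
  "strong_entropy_solution_H a lam eps T w0 w \<longleftrightarrow>
     (let u = (\<lambda>z. fst (w z)); v = (\<lambda>z. snd (w z)) in
       C_k T 1 u \<and> C_k T 1 v \<and>
       (\<forall>z \<in> QT T. dt T u z + dx v z = 0) \<and>
       (\<forall>z \<in> QT T. eps\<^sup>2 * dt T v z + lam\<^sup>2 * dx u z = a * u z - v z) \<and>
       (\<forall>z \<in> QT T.
          dt T (\<lambda>y. entropy a lam eps (w y)) z + dx (\<lambda>y. entropy_flux a lam eps (w y)) z
            \<le> - (a * u z - v z)\<^sup>2) \<and>
       (\<forall>x. w (x, 0) = w0 x))"

definition smooth_solution_P ::
  "real \<Rightarrow> real \<Rightarrow> real \<Rightarrow> (real \<Rightarrow> real \<times> real) \<Rightarrow> (real \<times> real \<Rightarrow> real \<times> real) \<Rightarrow> bool"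
where
  "smooth_solution_P a lam T w0 w \<longleftrightarrow>
     (let u = (\<lambda>z. fst (w z)); v = (\<lambda>z. snd (w z)) in
       smooth T u \<and> smooth T v \<and>
       (\<forall>z \<in> QT T. dt T u z + a * dx u z = lam\<^sup>2 * dx (dx u) z) \<and>
       (\<forall>z \<in> QT T. v z = a * u z - lam\<^sup>2 * dx u z) \<and>
       (\<forall>x. w (x, 0) = w0 x))"

definition in_L2 :: "(real \<times> real) set \<Rightarrow> (real \<times> real \<Rightarrow> real) \<Rightarrow> bool" where
  "in_L2 S f \<longleftrightarrow>
     set_borel_measurable lborel S f \<and> set_integrable lborel S (\<lambda>z. (f z)\<^sup>2)"

definition L2_norm_on :: "(real \<times> real) set \<Rightarrow> (real \<times> real \<Rightarrow> real) \<Rightarrow> real" where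
  "L2_norm_on S f = sqrt (LINT z:S|lborel. (f z)\<^sup>2)"

text \<open>The integrand is nonnegative under the subcharacteristic condition
  \<open>eps * \<bar>a\<bar> < lam\<close>, so \<open>ennreal\<close> truncates nothing and \<open>phi\<close> is the integral
  with values in \<open>[0, \<infinity>]\<close>.\<close>

definition phi ::
  "real \<Rightarrow> real \<Rightarrow> real \<Rightarrow> (real \<times> real \<Rightarrow> real \<times> real) \<Rightarrow> (real \<times> real \<Rightarrow> real \<times> real)
    \<Rightarrow> real \<Rightarrow> ennreal"
where
  "phi a lam eps w wb t =
     (\<integral>\<^sup>+ x. ennreal
        (let u = fst (w (x, t)); v = snd (w (x, t));
             ub = fst (wb (x, t)); vb = snd (wb (x, t)) in
          lam\<^sup>2 / 2 * (u - ub)\<^sup>2 + eps\<^sup>2 / 2 * (v - vb)\<^sup>2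
            - eps\<^sup>2 * a * (u - ub) * (v - vb)) \<partial>lborel)"

text \<open>All hypotheses that concern a single value of \<open>eps\<close>; \<open>wm\<close> and \<open>wp\<close> are the
  states at \<open>x \<rightarrow> -\<infinity>\<close> and \<open>x \<rightarrow> +\<infinity>\<close>.\<close>

definition relaxation_setting ::
  "real \<Rightarrow> real \<Rightarrow> real \<Rightarrow> real \<Rightarrow> real \<Rightarrow> (real \<Rightarrow> real \<times> real) \<Rightarrow> (real \<Rightarrow> real \<times> real)
    \<Rightarrow> (real \<times> real \<Rightarrow> real \<times> real) \<Rightarrow> (real \<times> real \<Rightarrow> real \<times> real)
    \<Rightarrow> real \<times> real \<Rightarrow> real \<times> real \<Rightarrow> bool"
where
  "relaxation_setting a lam T K eps w0 wb0 w wb wm wp \<longleftrightarrow>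
     eps > 0 \<and> lam > eps * \<bar>a\<bar> \<and>
     strong_entropy_solution_H a lam eps T w0 w \<and>
     smooth_solution_P a lam T wb0 wb \<and>
     (\<forall>t \<in> {0..<T}.
        ((\<lambda>x. w (x, t)) \<longlongrightarrow> wp) at_top \<and> ((\<lambda>x. wb (x, t)) \<longlongrightarrow> wp) at_top \<and>
        ((\<lambda>x. w (x, t)) \<longlongrightarrow> wm) at_bot \<and> ((\<lambda>x. wb (x, t)) \<longlongrightarrow> wm) at_bot) \<and>
     phi a lam eps w wb 0 < \<infinity> \<and>
     in_L2 (QT T) (dt T (\<lambda>z. snd (wb z))) \<and>
     L2_norm_on (QT T) (dt T (\<lambda>z. snd (wb z))) \<le> K"

end

theory Submission
  imports Defs
begin

text \<open>
  The parabolic solution also satisfies the relaxation system, up to an error: it obeys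
  \<open>\<partial>\<^sub>t \<bar>u + \<partial>\<^sub>x \<bar>v = 0\<close> and \<open>\<epsilon>\<^sup>2 \<partial>\<^sub>t \<bar>v + \<lambda>\<^sup>2 \<partial>\<^sub>x \<bar>u = a \<bar>u - \<bar>v + \<epsilon>\<^sup>2 \<partial>\<^sub>t \<bar>v\<close>.  Since the system is
  linear, the difference \<open>(p, q) = w - \<bar>w\<close> solves it with the source \<open>- \<epsilon>\<^sup>2 g\<close>, where
  \<open>g = \<partial>\<^sub>t \<bar>v\<close>, and since the entropy is quadratic, the relative entropy is the entropy \<open>e\<close> of
  \<open>(p, q)\<close>.  With \<open>f\<close> its flux, multiplying out gives
  \<open>\<partial>\<^sub>t e + \<partial>\<^sub>x f = - (q - a p)\<^sup>2 - \<epsilon>\<^sup>2 g (q - a p)\<close>, and completing the square bounds the right-hand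
  side by \<open>\<epsilon>\<^sup>4 g\<^sup>2 / 4\<close> (\<open>entropy_balance_le\<close>).

  Integrating this directly over the line would require control of the flux at infinity that is
  uniform in time.  Finite speed of propagation takes its place: the subcharacteristic condition
  yields \<open>\<bar>f\<bar> \<le> (\<lambda> / \<epsilon>) e\<close> (\<open>entropy_flux_le_speed\<close>).  So the
  balance is multiplied by a \<open>C\<^sup>1\<close> weight, compactly supported in \<open>x\<close>, whose level sets move inwards
  with speed at least \<open>\<lambda> / \<epsilon>\<close>; the terms in which the weight is differentiated then have a
  favourable sign (\<open>localized_energy_estimate\<close>).  The weight lies between 0 and 1 and tends to 1
  when its radius grows, so Fatou's lemma turns the localized estimates into
  \<open>\<phi>(t) \<le> \<phi>(0) + K\<^sup>2 \<epsilon>\<^sup>4 / 4\<close> (\<open>phi_le\<close>).  The bound is uniform in \<open>t\<close>, and the convergence as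
  \<open>\<epsilon> \<rightarrow> 0\<close> follows by squeezing.
\<close>

section \<open>Integrating a balance law over a rectangle\<close>

text \<open>Fubini and the fundamental theorem of calculus in each variable.  The differences of boundary
  values stand under one integral because they are integrals of \<open>A\<close> and \<open>B\<close>, whose continuity
  makes these functions of the remaining variable integrable.\<close>

lemma rectangle_divergence_le:
  fixes E F A B G :: "real \<times> real \<Rightarrow> real"
  assumes "x0 \<le> x1" and "0 \<le> t"
    and dE: "\<And>x s. x \<in> {x0..x1} \<Longrightarrow> s \<in> {0..t} \<Longrightarrow>
      ((\<lambda>s. E (x, s)) has_real_derivative A (x, s)) (at s within {0..t})"
    and dF: "\<And>x s. x \<in> {x0..x1} \<Longrightarrow> s \<in> {0..t} \<Longrightarrow>
      ((\<lambda>x. F (x, s)) has_real_derivative B (x, s)) (at x within {x0..x1})"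
    and cont: "continuous_on ({x0..x1} \<times> {0..t}) A" "continuous_on ({x0..x1} \<times> {0..t}) B"
      "continuous_on ({x0..x1} \<times> {0..t}) G"
    and le: "\<And>z. z \<in> {x0..x1} \<times> {0..t} \<Longrightarrow> A z + B z \<le> G z"
  shows "integral {x0..x1} (\<lambda>x. E (x, t) - E (x, 0))
      + integral {0..t} (\<lambda>s. F (x1, s) - F (x0, s))
    \<le> integral ({x0..x1} \<times> {0..t}) G"
proof -
  have box: "cbox (x0, 0) (x1, t) = {x0..x1} \<times> {0..t}"
    by (simp add: cbox_Pair_eq)
  have int: "A integrable_on {x0..x1} \<times> {0..t}" "B integrable_on {x0..x1} \<times> {0..t}"
      "G integrable_on {x0..x1} \<times> {0..t}"
    using cont by (auto simp flip: box intro: integrable_continuous)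
  have "integral {x0..x1} (\<lambda>x. E (x, t) - E (x, 0))
      = integral {x0..x1} (\<lambda>x. integral {0..t} (\<lambda>s. A (x, s)))"
  proof (rule integral_cong)
    fix x assume "x \<in> {x0..x1}"
    then show "E (x, t) - E (x, 0) = integral {0..t} (\<lambda>s. A (x, s))"
      using fundamental_theorem_of_calculus[of 0 t "\<lambda>s. E (x, s)" "\<lambda>s. A (x, s)"] dE \<open>0 \<le> t\<close>
      by (simp add: has_real_derivative_iff_has_vector_derivative integral_unique)
  qed
  also have "\<dots> = integral ({x0..x1} \<times> {0..t}) A"
    using integral_prod_continuous[of x0 0 x1 t A] cont(1) by (simp add: box)
  finally have 1: "integral {x0..x1} (\<lambda>x. E (x, t) - E (x, 0)) = integral ({x0..x1} \<times> {0..t}) A" .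
  have "integral {0..t} (\<lambda>s. F (x1, s) - F (x0, s))
      = integral {0..t} (\<lambda>s. integral {x0..x1} (\<lambda>x. B (x, s)))"
  proof (rule integral_cong)
    fix s assume "s \<in> {0..t}"
    then show "F (x1, s) - F (x0, s) = integral {x0..x1} (\<lambda>x. B (x, s))"
      using fundamental_theorem_of_calculus[of x0 x1 "\<lambda>x. F (x, s)" "\<lambda>x. B (x, s)"] dF \<open>x0 \<le> x1\<close>
      by (simp add: has_real_derivative_iff_has_vector_derivative integral_unique)
  qed
  also have "\<dots> = integral {x0..x1} (\<lambda>x. integral {0..t} (\<lambda>s. B (x, s)))"
    using integral_swap_continuous[of x0 0 x1 t "\<lambda>x s. B (x, s)"] cont(2) by (simp add: box)
  also have "\<dots> = integral ({x0..x1} \<times> {0..t}) B"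
    using integral_prod_continuous[of x0 0 x1 t B] cont(2) by (simp add: box)
  finally have 2: "integral {0..t} (\<lambda>s. F (x1, s) - F (x0, s)) = integral ({x0..x1} \<times> {0..t}) B" .
  show ?thesis
    unfolding 1 2 integral_add[OF int(1,2), symmetric]
    by (intro integral_le integrable_add int le)
qed

section \<open>The entropy and its flux\<close>

text \<open>Both \<open>c E - F\<close> and \<open>c E + F\<close> are nonnegative multiples of perfect squares at the
  characteristic speed \<open>c = \<lambda> / \<epsilon>\<close> of the relaxation system, the multiples being \<open>(c \<plusminus> a) / 2\<close>.\<close>

lemma entropy_flux_le_speed:
  assumes "eps > 0" and "lam > eps * \<bar>a\<bar>"
  shows "\<bar>entropy_flux a lam eps w\<bar> \<le> lam / eps * entropy a lam eps w"
proof -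
  obtain u v where w: "w = (u, v)" by fastforce
  have c: "\<bar>a\<bar> < lam / eps"
    using assms by (simp add: field_simps)
  have "lam / eps * entropy a lam eps w - entropy_flux a lam eps w
      = (lam / eps + a) / 2 * (lam * u - eps * v)\<^sup>2"
    using assms by (simp add: w entropy_def entropy_flux_def field_simps power2_eq_square)
  moreover have "lam / eps * entropy a lam eps w + entropy_flux a lam eps w
      = (lam / eps - a) / 2 * (lam * u + eps * v)\<^sup>2"
    using assms by (simp add: w entropy_def entropy_flux_def field_simps power2_eq_square)
  moreover have "(lam / eps + a) / 2 * (lam * u - eps * v)\<^sup>2 \<ge> 0"
      "(lam / eps - a) / 2 * (lam * u + eps * v)\<^sup>2 \<ge> 0"
    using c by (auto intro!: mult_nonneg_nonneg)
  ultimately show ?thesis by linarith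
qed

text \<open>\<open>E\<close> dominates \<open>\<bar>F\<bar> \<ge> 0\<close> up to a positive factor.\<close>

lemma entropy_nonneg:
  assumes "eps > 0" and "lam > eps * \<bar>a\<bar>"
  shows "entropy a lam eps w \<ge> 0"
proof -
  have "lam > 0"
    using assms by (smt (verit) abs_ge_zero mult_nonneg_nonneg)
  then show ?thesis
    using entropy_flux_le_speed[OF assms, of w] assms
    by (smt (verit) divide_pos_pos mult_pos_neg)
qed

text \<open>The entropy balance at a single point: the variables stand for \<open>p\<close>, \<open>q\<close>, \<open>g\<close> and the partial
  derivatives of \<open>p\<close> and \<open>q\<close> there, and the left-hand side is \<open>\<partial>\<^sub>t E + \<partial>\<^sub>x F\<close> expanded by the chain
  rule.  It equals \<open>- r\<^sup>2 + \<epsilon>\<^sup>2 g r\<close> with \<open>r = a p - q\<close>: the dissipation of the relaxation absorbs the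
  factor \<open>r\<close> of the error term.\<close>

lemma entropy_balance_le:
  fixes a lam eps p q g pt px qt qx :: real
  assumes "pt + qx = 0" and "eps\<^sup>2 * qt + lam\<^sup>2 * px = a * p - q - eps\<^sup>2 * g"
  shows "(lam\<^sup>2 * p * pt + eps\<^sup>2 * q * qt - eps\<^sup>2 * a * (pt * q + p * qt))
      + (- (lam\<^sup>2 * a) * p * px - eps\<^sup>2 * a * q * qx + lam\<^sup>2 * (px * q + p * qx))
    \<le> eps ^ 4 / 4 * g\<^sup>2"
    (is "?L \<le> _")
proof -
  have qx: "qx = - pt" using assms(1) by simp
  have *: "eps\<^sup>2 * qt = a * p - q - eps\<^sup>2 * g - lam\<^sup>2 * px" using assms(2) by simp
  have "?L = (q - a * p) * (eps\<^sup>2 * qt) + lam\<^sup>2 * px * (q - a * p)"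
    by (simp add: qx algebra_simps)
  also have "\<dots> = eps ^ 4 / 4 * g\<^sup>2 - (eps\<^sup>2 / 2 * g - (a * p - q))\<^sup>2"
    unfolding * by (simp add: field_simps power2_eq_square power4_eq_xxxx)
  finally show ?thesis by simp
qed

section \<open>A weight supported in a backward cone\<close>

text \<open>The term \<open>c s + sqrt (1 + x\<^sup>2)\<close> is a smooth substitute for \<open>c s + \<bar>x\<bar>\<close>, so the support lies in
  the backward cone \<open>\<bar>x\<bar> \<le> R - c s\<close>; squaring the positive part makes the weight \<open>C\<^sup>1\<close> across the
  boundary of its support.\<close>

definition cone_weight :: "real \<Rightarrow> real \<Rightarrow> real \<times> real \<Rightarrow> real" where
  "cone_weight c R = (\<lambda>(x, s). (max 0 (1 - (c * s + sqrt (1 + x\<^sup>2)) / R))\<^sup>2)"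

lemma has_real_derivative_pos_part_squared:
  "((\<lambda>z::real. (max 0 z)\<^sup>2) has_real_derivative 2 * max 0 z) (at z)"
proof (cases z "0::real" rule: linorder_cases)
  case less
  have "((\<lambda>z::real. 0) has_real_derivative 0) (at z)" by simp
  then have "((\<lambda>z::real. (max 0 z)\<^sup>2) has_real_derivative 0) (at z)"
    by (rule has_field_derivative_transform_within_open[of _ _ _ "{..<0}"]) (use less in auto)
  with less show ?thesis by simp
next
  case greater
  have "((\<lambda>z::real. z\<^sup>2) has_real_derivative 2 * z) (at z)"
    by (auto intro!: derivative_eq_intros)
  then have "((\<lambda>z::real. (max 0 z)\<^sup>2) has_real_derivative 2 * z) (at z)"
    by (rule has_field_derivative_transform_within_open[of _ _ _ "{0<..}"]) (use greater in auto)
  with greater show ?thesis by simp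
next
  case equal
  \<comment> \<open>Where the two branches meet, the difference quotient at \<open>h\<close> is at most \<open>\<bar>h\<bar>\<close>.\<close>
  have "((\<lambda>h::real. (max 0 h)\<^sup>2 / h) \<longlongrightarrow> 0) (at 0)"
  proof (rule Lim_null_comparison)
    show "\<forall>\<^sub>F h::real in at 0. norm ((max 0 h)\<^sup>2 / h) \<le> \<bar>h\<bar>"
      by (auto simp: max_def power2_eq_square)
    show "((\<lambda>h::real. \<bar>h\<bar>) \<longlongrightarrow> 0) (at 0)"
      by (auto intro!: tendsto_eq_intros)
  qed
  with equal show ?thesis by (simp add: DERIV_def)
qed

lemma has_real_derivative_cone_weight_time:
  assumes "R \<noteq> 0"
  shows "((\<lambda>s. cone_weight c R (x, s)) has_real_derivative
      - 2 * c / R * max 0 (1 - (c * s + sqrt (1 + x\<^sup>2)) / R)) (at s within S)"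
proof -
  have "((\<lambda>s. 1 - (c * s + sqrt (1 + x\<^sup>2)) / R) has_real_derivative - c / R) (at s within S)"
    using assms by (auto intro!: derivative_eq_intros)
  from DERIV_chain2[OF has_real_derivative_pos_part_squared this]
  show ?thesis by (simp add: cone_weight_def mult_ac)
qed

lemma has_real_derivative_cone_weight_space:
  assumes "R \<noteq> 0"
  shows "((\<lambda>x. cone_weight c R (x, s)) has_real_derivative
      - 2 / R * max 0 (1 - (c * s + sqrt (1 + x\<^sup>2)) / R) * (x / sqrt (1 + x\<^sup>2))) (at x within S)"
proof -
  have pos: "1 + x\<^sup>2 > 0" by (smt (verit) zero_le_power2)
  have "((\<lambda>x. 1 - (c * s + sqrt (1 + x\<^sup>2)) / R) has_real_derivative
      - (x / sqrt (1 + x\<^sup>2)) / R) (at x within S)"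
    using assms pos by (auto intro!: derivative_eq_intros simp: field_simps)
  from DERIV_chain2[OF has_real_derivative_pos_part_squared this]
  show ?thesis by (simp add: cone_weight_def mult_ac)
qed

lemma cone_weight_bounds:
  assumes "0 \<le> c" "0 \<le> s" "0 < R"
  shows "0 \<le> cone_weight c R (x, s)" "cone_weight c R (x, s) \<le> 1"
proof -
  have "0 \<le> (c * s + sqrt (1 + x\<^sup>2)) / R"
    using assms by simp
  then have "max 0 (1 - (c * s + sqrt (1 + x\<^sup>2)) / R) \<le> 1" by simp
  then show "cone_weight c R (x, s) \<le> 1"
    by (simp add: cone_weight_def power_le_one)
qed (simp add: cone_weight_def)

lemma cone_weight_eq_0:
  assumes "0 \<le> c" "0 \<le> s" "0 < R" "R \<le> \<bar>x\<bar>"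
  shows "cone_weight c R (x, s) = 0"
proof -
  have "\<bar>x\<bar> \<le> sqrt (1 + x\<^sup>2)"
    by (intro real_le_rsqrt) simp
  then have "R \<le> c * s + sqrt (1 + x\<^sup>2)"
    using assms by (smt (verit) mult_nonneg_nonneg)
  then show ?thesis
    using assms by (simp add: cone_weight_def max_def)
qed

lemma continuous_on_cone_weight:
  "R \<noteq> 0 \<Longrightarrow> continuous_on S (cone_weight c R)"
  unfolding cone_weight_def case_prod_unfold by (intro continuous_intros) auto

lemma tendsto_cone_weight:
  "((\<lambda>R. cone_weight c R z) \<longlongrightarrow> 1) at_top"
proof -
  obtain x s where z: "z = (x, s)" by fastforce
  have "((\<lambda>R. k / R) \<longlongrightarrow> 0) at_top" for k :: real
    by (intro tendsto_divide_0[OF tendsto_const] filterlim_at_top_imp_at_infinity filterlim_ident)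
  then have "((\<lambda>R. (max 0 (1 - (c * s + sqrt (1 + x\<^sup>2)) / R))\<^sup>2) \<longlongrightarrow> (max 0 (1 - 0))\<^sup>2) at_top"
    by (intro tendsto_intros)
  then show ?thesis by (simp add: cone_weight_def z)
qed

section \<open>The localized energy estimate\<close>

text \<open>The balance of entropy, weighted by \<open>cone_weight\<close> and integrated over a rectangle that
  contains the support of the weight up to time \<open>t\<close>, so that no flux crosses the lateral sides.
  Differentiating the weight produces \<open>- (2 / R) m (c E + y F)\<close>, where \<open>E\<close> and \<open>F\<close> are the entropy
  and the flux of \<open>(p, q)\<close>, \<open>m\<close> is the square root of the weight, \<open>c = \<lambda> / \<epsilon>\<close> and
  \<open>y = x / sqrt (1 + x\<^sup>2)\<close>; as \<open>\<bar>y\<bar> \<le> 1\<close> and \<open>\<bar>F\<bar> \<le> c E\<close>, this term is at most 0.\<close>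

lemma localized_energy_estimate:
  fixes p q g :: "real \<times> real \<Rightarrow> real"
  assumes "eps > 0" and "lam > eps * \<bar>a\<bar>" and "0 \<le> t" and "0 < R"
    and pt: "\<And>x s. s \<in> {0..t} \<Longrightarrow>
      ((\<lambda>s. p (x, s)) has_real_derivative pt (x, s)) (at s within {0..t})"
    and qt: "\<And>x s. s \<in> {0..t} \<Longrightarrow>
      ((\<lambda>s. q (x, s)) has_real_derivative qt (x, s)) (at s within {0..t})"
    and px: "\<And>x s. s \<in> {0..t} \<Longrightarrow> ((\<lambda>x. p (x, s)) has_real_derivative px (x, s)) (at x)"
    and qx: "\<And>x s. s \<in> {0..t} \<Longrightarrow> ((\<lambda>x. q (x, s)) has_real_derivative qx (x, s)) (at x)"
    and cont: "continuous_on (UNIV \<times> {0..t}) p" "continuous_on (UNIV \<times> {0..t}) q"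
      "continuous_on (UNIV \<times> {0..t}) pt" "continuous_on (UNIV \<times> {0..t}) qt"
      "continuous_on (UNIV \<times> {0..t}) px" "continuous_on (UNIV \<times> {0..t}) qx"
      "continuous_on (UNIV \<times> {0..t}) g"
    and eq1: "\<And>z. z \<in> UNIV \<times> {0..t} \<Longrightarrow> pt z + qx z = 0"
    and eq2: "\<And>z. z \<in> UNIV \<times> {0..t} \<Longrightarrow>
      eps\<^sup>2 * qt z + lam\<^sup>2 * px z = a * p z - q z - eps\<^sup>2 * g z"
  defines "e \<equiv> \<lambda>z. cone_weight (lam / eps) R z * entropy a lam eps (p z, q z)"
  shows "integral {- R..R} (\<lambda>x. e (x, t) - e (x, 0))
    \<le> eps ^ 4 / 4 * integral ({- R..R} \<times> {0..t}) (\<lambda>z. (g z)\<^sup>2)"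
proof -
  define c where "c = lam / eps"
  have "lam > 0"
    using assms(1,2) by (smt (verit) abs_ge_zero mult_nonneg_nonneg)
  then have "c > 0" using \<open>eps > 0\<close> by (simp add: c_def)
  let ?k = "cone_weight c R"
  let ?m = "\<lambda>x s. max 0 (1 - (c * s + sqrt (1 + x\<^sup>2)) / R)"
  let ?e = "\<lambda>z. entropy a lam eps (p z, q z)"
  let ?f = "\<lambda>z. entropy_flux a lam eps (p z, q z)"
  let ?et = "\<lambda>z. lam\<^sup>2 * p z * pt z + eps\<^sup>2 * q z * qt z
    - eps\<^sup>2 * a * (pt z * q z + p z * qt z)"
  let ?fx = "\<lambda>z. - (lam\<^sup>2 * a) * p z * px z - eps\<^sup>2 * a * q z * qx z
    + lam\<^sup>2 * (px z * q z + p z * qx z)"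
  \<comment> \<open>\<open>A\<close> and \<open>B\<close> are \<open>\<partial>\<^sub>t\<close> of the weighted entropy and \<open>\<partial>\<^sub>x\<close> of the weighted flux.\<close>
  define A where "A = (\<lambda>z. - 2 * c / R * ?m (fst z) (snd z) * ?e z + ?k z * ?et z)"
  define B where "B = (\<lambda>z. - 2 / R * ?m (fst z) (snd z)
      * (fst z / sqrt (1 + (fst z)\<^sup>2)) * ?f z + ?k z * ?fx z)"
  have sqrt_ne_0: "sqrt (1 + x\<^sup>2) \<noteq> 0" for x :: real
    by (smt (verit) real_sqrt_eq_zero_cancel_iff zero_le_power2)
  note cont' = cont[THEN continuous_on_subset, OF Sigma_mono[OF subset_UNIV order_refl]]
  have "integral {- R..R} (\<lambda>x. ?k (x, t) * ?e (x, t) - ?k (x, 0) * ?e (x, 0))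
      + integral {0..t} (\<lambda>s. ?k (R, s) * ?f (R, s) - ?k (- R, s) * ?f (- R, s))
    \<le> integral ({- R..R} \<times> {0..t}) (\<lambda>z. eps ^ 4 / 4 * (g z)\<^sup>2)"
  proof (rule rectangle_divergence_le[where A = A and B = B])
    show "- R \<le> R" "0 \<le> t" using \<open>0 < R\<close> \<open>0 \<le> t\<close> by auto
  next
    fix x s assume s: "s \<in> {0..t}"
    have "((\<lambda>s. ?e (x, s)) has_real_derivative ?et (x, s)) (at s within {0..t})"
      unfolding entropy_def prod.case
      by (rule derivative_eq_intros pt[OF s] qt[OF s] refl)+
        (simp add: algebra_simps)
    from DERIV_mult[OF has_real_derivative_cone_weight_time[of R c x] this]
    show "((\<lambda>s. ?k (x, s) * ?e (x, s)) has_real_derivative A (x, s)) (at s within {0..t})"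
      using \<open>0 < R\<close> by (simp add: A_def algebra_simps)
    have "((\<lambda>x. ?f (x, s)) has_real_derivative ?fx (x, s)) (at x)"
      unfolding entropy_flux_def prod.case
      by (rule derivative_eq_intros px[OF s] qx[OF s] refl)+
        (simp add: algebra_simps)
    from DERIV_mult[OF has_real_derivative_cone_weight_space has_field_derivative_at_within[OF this],
        of R c s "{- R..R}"]
    show "((\<lambda>x. ?k (x, s) * ?f (x, s)) has_real_derivative B (x, s)) (at x within {- R..R})"
      using \<open>0 < R\<close> by (simp add: B_def algebra_simps)
  next
    show "continuous_on ({- R..R} \<times> {0..t}) A"
      unfolding A_def entropy_def prod.case
      using \<open>0 < R\<close> by (intro continuous_intros continuous_on_cone_weight cont') auto
    show "continuous_on ({- R..R} \<times> {0..t}) B"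
      unfolding B_def entropy_flux_def prod.case
      using \<open>0 < R\<close> sqrt_ne_0 by (intro continuous_intros continuous_on_cone_weight cont') auto
    show "continuous_on ({- R..R} \<times> {0..t}) (\<lambda>z. eps ^ 4 / 4 * (g z)\<^sup>2)"
      by (intro continuous_intros cont')
  next
    fix z assume z: "z \<in> {- R..R} \<times> {0..t}"
    obtain x s where xs: "z = (x, s)" by fastforce
    let ?y = "x / sqrt (1 + x\<^sup>2)"
    have "\<bar>x\<bar> \<le> sqrt (1 + x\<^sup>2)"
      by (intro real_le_rsqrt) simp
    then have "\<bar>?y\<bar> \<le> 1"
      using add_pos_nonneg[of 1 "x\<^sup>2"] by (simp add: abs_divide divide_le_eq_1)
    then have "\<bar>?y * ?f z\<bar> \<le> 1 * \<bar>?f z\<bar>"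
      unfolding abs_mult by (rule mult_right_mono) simp
    then have "0 \<le> c * ?e z + ?y * ?f z"
      using entropy_flux_le_speed[OF assms(1,2), of "(p z, q z)"]
      unfolding c_def by linarith
    then have lateral: "0 \<le> 2 / R * ?m x s * (c * ?e z + ?y * ?f z)"
      using \<open>0 < R\<close> by simp
    have k: "0 \<le> ?k z" "?k z \<le> 1"
      using cone_weight_bounds[of c s R x] \<open>c > 0\<close> \<open>0 < R\<close> z by (auto simp: xs)
    have "?et z + ?fx z \<le> eps ^ 4 / 4 * (g z)\<^sup>2"
      using entropy_balance_le[OF eq1 eq2] z by blast
    then have "?k z * (?et z + ?fx z) \<le> 1 * (eps ^ 4 / 4 * (g z)\<^sup>2)"
      by (intro order.trans[OF mult_left_mono mult_right_mono] k) auto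
    moreover have "A z + B z
        = ?k z * (?et z + ?fx z) - 2 / R * ?m x s * (c * ?e z + ?y * ?f z)"
      by (simp add: A_def B_def xs algebra_simps)
    ultimately show "A z + B z \<le> eps ^ 4 / 4 * (g z)\<^sup>2"
      using lateral by simp
  qed
  moreover have "integral {0..t} (\<lambda>s. ?k (R, s) * ?f (R, s) - ?k (- R, s) * ?f (- R, s)) = 0"
    using cone_weight_eq_0[of c _ R] \<open>c > 0\<close> \<open>0 < R\<close>
    by (intro integral_unique has_integral_is_0) auto
  ultimately show ?thesis
    by (simp add: e_def c_def)
qed

section \<open>The parabolic solution inside the relaxation system\<close>

lemma C_k_1_derivatives:
  assumes "C_k T 1 f" and "t < T" and "s \<in> {0..t}"
  shows "((\<lambda>s. f (x, s)) has_real_derivative dt T f (x, s)) (at s within {0..t})"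
    and "((\<lambda>x. f (x, s)) has_real_derivative dx f (x, s)) (at x)"
proof -
  have diff: "(\<lambda>y. f (y, s)) differentiable (at x)"
      "(\<lambda>s. f (x, s)) differentiable (at s within {0..<T})"
    using assms by (auto simp: QT_def)
  have "((\<lambda>s. f (x, s)) has_vector_derivative dt T f (x, s)) (at s within {0..<T})"
    using diff(2) by (simp add: dt_def vector_derivative_works)
  then show "((\<lambda>s. f (x, s)) has_real_derivative dt T f (x, s)) (at s within {0..t})"
    unfolding has_real_derivative_iff_has_vector_derivative
    by (rule has_vector_derivative_within_subset) (use \<open>t < T\<close> in auto)
  show "((\<lambda>x. f (x, s)) has_real_derivative dx f (x, s)) (at x)"
    using diff(1) by (simp add: dx_def DERIV_deriv_iff_real_differentiable)
qed

lemma C_k_1_continuous: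
  assumes "C_k T 1 f" and "t < T"
  shows "continuous_on (UNIV \<times> {0..t}) f" "continuous_on (UNIV \<times> {0..t}) (dt T f)"
    "continuous_on (UNIV \<times> {0..t}) (dx f)"
proof -
  have "UNIV \<times> {0..t} \<subseteq> QT T"
    using \<open>t < T\<close> by (auto simp: QT_def)
  with assms(1) show "continuous_on (UNIV \<times> {0..t}) f" "continuous_on (UNIV \<times> {0..t}) (dt T f)"
    "continuous_on (UNIV \<times> {0..t}) (dx f)"
    by (auto intro: continuous_on_subset)
qed

lemma smooth_imp_C_k_1: "smooth T f \<Longrightarrow> C_k T 1 f"
  unfolding smooth_def by blast

lemma smooth_dx: "smooth T f \<Longrightarrow> smooth T (dx f)"
  unfolding smooth_def by (metis C_k.simps(2))

text \<open>The convection-diffusion equation is the conservation law for the flux \<open>\<bar>v\<close>, because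
  differentiating the constitutive relation gives \<open>\<partial>\<^sub>x \<bar>v = a \<partial>\<^sub>x \<bar>u - \<lambda>\<^sup>2 \<partial>\<^sub>x\<^sub>x \<bar>u\<close>; the constitutive
  relation itself is the second equation of the relaxation system without its term
  \<open>\<epsilon>\<^sup>2 \<partial>\<^sub>t \<bar>v\<close>.\<close>

lemma parabolic_solution_solves_relaxation_system:
  assumes "smooth_solution_P a lam T wb0 wb" and "(x, s) \<in> QT T"
  shows "dt T (\<lambda>z. fst (wb z)) (x, s) + dx (\<lambda>z. snd (wb z)) (x, s) = 0"
    and "lam\<^sup>2 * dx (\<lambda>z. fst (wb z)) (x, s) = a * fst (wb (x, s)) - snd (wb (x, s))"
proof -
  let ?u = "\<lambda>z. fst (wb z)" and ?v = "\<lambda>z. snd (wb z)"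
  have sm: "smooth T ?u"
    and P: "\<And>z. z \<in> QT T \<Longrightarrow> dt T ?u z + a * dx ?u z = lam\<^sup>2 * dx (dx ?u) z"
    and v: "\<And>z. z \<in> QT T \<Longrightarrow> ?v z = a * ?u z - lam\<^sup>2 * dx ?u z"
    using assms(1) by (auto simp: smooth_solution_P_def Let_def)
  have s: "s < T" "s \<in> {0..s}" and y: "\<And>y. (y, s) \<in> QT T"
    using assms(2) by (auto simp: QT_def)
  have "((\<lambda>y. a * ?u (y, s) - lam\<^sup>2 * dx ?u (y, s)) has_real_derivative
      a * dx ?u (x, s) - lam\<^sup>2 * dx (dx ?u) (x, s)) (at x)"
    by (intro DERIV_diff DERIV_cmult C_k_1_derivatives(2)[OF _ s] smooth_imp_C_k_1 smooth_dx sm)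
  then have "((\<lambda>y. ?v (y, s)) has_real_derivative
      a * dx ?u (x, s) - lam\<^sup>2 * dx (dx ?u) (x, s)) (at x)"
    using v[OF y] by simp
  then have "dx ?v (x, s) = a * dx ?u (x, s) - lam\<^sup>2 * dx (dx ?u) (x, s)"
    unfolding dx_def prod.case by (rule DERIV_imp_deriv)
  with P[OF y, of x] show "dt T ?u (x, s) + dx ?v (x, s) = 0" by simp
  show "lam\<^sup>2 * dx ?u (x, s) = a * ?u (x, s) - ?v (x, s)"
    using v[OF y] by simp
qed

section \<open>The estimate on the whole line\<close>

text \<open>A bridge between the gauge integral, in which the localized estimate is stated, and the
  Lebesgue integral in the \<open>L\<^sup>2\<close> norm.\<close>

lemma integral_square_le_L2_norm:
  assumes "in_L2 S f" and "compact B" and "B \<subseteq> S" and "continuous_on B f"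
    and "L2_norm_on S f \<le> K"
  shows "integral B (\<lambda>z. (f z)\<^sup>2) \<le> K\<^sup>2"
proof -
  have S: "set_integrable lborel S (\<lambda>z. (f z)\<^sup>2)"
    using assms(1) by (simp add: in_L2_def)
  have B: "set_integrable lborel B (\<lambda>z. (f z)\<^sup>2)"
    by (intro borel_integrable_compact[folded set_integrable_def] continuous_on_power assms(2,4))
  have "integral B (\<lambda>z. (f z)\<^sup>2) = (LINT z:B|lborel. (f z)\<^sup>2)"
    using set_borel_integral_eq_integral(2)[OF B] by simp
  also have "\<dots> \<le> (LINT z:S|lborel. (f z)\<^sup>2)"
    unfolding set_lebesgue_integral_def
    using S B \<open>B \<subseteq> S\<close> by (intro integral_mono) (auto simp: set_integrable_def indicator_def)
  also have "\<dots> \<le> K\<^sup>2"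
  proof -
    have "0 \<le> (LINT z:S|lborel. (f z)\<^sup>2)"
      unfolding set_lebesgue_integral_def by (intro integral_nonneg_AE) auto
    then show ?thesis
      using assms(5) unfolding L2_norm_on_def by (metis sqrt_le_D)
  qed
  finally show ?thesis .
qed

lemma phi_eq_entropy:
  "phi a lam eps w wb t
    = (\<integral>\<^sup>+ x. ennreal (entropy a lam eps
        (fst (w (x, t)) - fst (wb (x, t)), snd (w (x, t)) - snd (wb (x, t)))) \<partial>lborel)"
  by (simp add: phi_def entropy_def Let_def case_prod_unfold)

text \<open>The constant is the one that completing the square gives; since the
  weight is at most 1, the localized initial entropy is at most \<open>\<phi>(0)\<close> for every radius, and the
  radius may tend to infinity along the integers.\<close>

lemma phi_le:
  assumes "0 \<le> t" and "t < T" and "relaxation_setting a lam T K eps w0 wb0 w wb wm wp"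
  shows "phi a lam eps w wb t \<le> phi a lam eps w wb 0 + ennreal (K\<^sup>2 / 4 * eps ^ 4)"
proof -
  let ?u = "\<lambda>z. fst (w z)" and ?v = "\<lambda>z. snd (w z)"
  let ?ub = "\<lambda>z. fst (wb z)" and ?vb = "\<lambda>z. snd (wb z)"
  let ?g = "dt T ?vb"
  let ?e = "\<lambda>z. entropy a lam eps (?u z - ?ub z, ?v z - ?vb z)"
  have eps: "eps > 0" "lam > eps * \<bar>a\<bar>"
    and L2: "in_L2 (QT T) ?g" "L2_norm_on (QT T) ?g \<le> K"
    and H: "strong_entropy_solution_H a lam eps T w0 w"
    and P: "smooth_solution_P a lam T wb0 wb"
    using assms(3) by (auto simp: relaxation_setting_def)
  have C1: "C_k T 1 ?u" "C_k T 1 ?v"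
    and H1: "\<And>z. z \<in> QT T \<Longrightarrow> dt T ?u z + dx ?v z = 0"
    and H2: "\<And>z. z \<in> QT T \<Longrightarrow> eps\<^sup>2 * dt T ?v z + lam\<^sup>2 * dx ?u z = a * ?u z - ?v z"
    using H by (auto simp: strong_entropy_solution_H_def Let_def simp del: C_k.simps)
  have C1b: "C_k T 1 ?ub" "C_k T 1 ?vb"
    using P smooth_imp_C_k_1 unfolding smooth_solution_P_def Let_def by blast+
  have strip: "UNIV \<times> {0..t} \<subseteq> QT T"
    using \<open>t < T\<close> by (auto simp: QT_def)
  have "lam > 0"
    using eps by (smt (verit) abs_ge_zero mult_nonneg_nonneg)
  define c where "c = lam / eps"
  have "c > 0" using eps \<open>lam > 0\<close> by (simp add: c_def)
  have e_nonneg: "0 \<le> ?e z" for z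
    using entropy_nonneg[OF eps] .
  have h_cont: "continuous_on UNIV (\<lambda>x. cone_weight c R (x, s) * ?e (x, s))"
    if s: "s \<in> {0..t}" and "R > 0" for s R
  proof -
    have slice: "continuous_on UNIV (\<lambda>x. f (x, s))" if "continuous_on (UNIV \<times> {0..t}) f"
      for f :: "real \<times> real \<Rightarrow> real"
      by (rule continuous_on_compose2[OF that]) (use s in \<open>auto intro!: continuous_intros\<close>)
    have "continuous_on (UNIV \<times> {0..t}) (\<lambda>z. cone_weight c R z * ?e z)"
      unfolding entropy_def prod.case
      using \<open>R > 0\<close> C_k_1_continuous(1)[OF _ \<open>t < T\<close>] C1 C1b
      by (intro continuous_on_mult continuous_on_add continuous_on_diff continuous_on_power
          continuous_on_const continuous_on_cone_weight) auto
    then show ?thesis by (rule slice)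
  qed
  have cone: "(\<integral>\<^sup>+ x. ennreal (cone_weight c R (x, t) * ?e (x, t)) \<partial>lborel)
      \<le> phi a lam eps w wb 0 + ennreal (K\<^sup>2 / 4 * eps ^ 4)" if "R > 0" for R
  proof -
    let ?h = "\<lambda>s x. cone_weight c R (x, s) * ?e (x, s)"
    let ?I = "\<lambda>s. integral {- R..R} (?h s)"
    have h_int: "?h s integrable_on {- R..R}" if "s \<in> {0..t}" for s
      using continuous_on_subset[OF h_cont[OF that \<open>R > 0\<close>]] by (intro integrable_continuous_interval) auto
    have h_nn: "(\<integral>\<^sup>+ x. ennreal (?h s x) \<partial>lborel) = ennreal (?I s)" if s: "s \<in> {0..t}" for s
    proof (rule nn_integral_has_integral_lborel)
      show "?h s \<in> borel_measurable borel"
        using h_cont[OF s \<open>R > 0\<close>] by (rule borel_measurable_continuous_onI)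
      show "0 \<le> ?h s x" for x
        using cone_weight_bounds[of c s R x] e_nonneg[of "(x, s)"] s \<open>c > 0\<close> \<open>R > 0\<close> by simp
      show "(?h s has_integral ?I s) UNIV"
        by (rule has_integral_on_superset[OF integrable_integral[OF h_int[OF s]]])
          (use cone_weight_eq_0[of c s R] s \<open>c > 0\<close> \<open>R > 0\<close> in auto)
    qed
    have "?I t - ?I 0 = integral {- R..R} (\<lambda>x. ?h t x - ?h 0 x)"
      using \<open>0 \<le> t\<close> by (intro integral_diff[symmetric] h_int) auto
    also have "\<dots> \<le> eps ^ 4 / 4 * integral ({- R..R} \<times> {0..t}) (\<lambda>z. (?g z)\<^sup>2)"
    proof -
      have "integral {- R..R} (\<lambda>x. cone_weight (lam / eps) R (x, t) * ?e (x, t)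
          - cone_weight (lam / eps) R (x, 0) * ?e (x, 0))
        \<le> eps ^ 4 / 4 * integral ({- R..R} \<times> {0..t}) (\<lambda>z. (?g z)\<^sup>2)"
      proof (rule localized_energy_estimate[OF eps \<open>0 \<le> t\<close> \<open>R > 0\<close>,
            where pt = "\<lambda>z. dt T ?u z - dt T ?ub z" and px = "\<lambda>z. dx ?u z - dx ?ub z"
              and qt = "\<lambda>z. dt T ?v z - dt T ?vb z" and qx = "\<lambda>z. dx ?v z - dx ?vb z"])
        fix z :: "real \<times> real" assume "z \<in> UNIV \<times> {0..t}"
        with strip have z: "z \<in> QT T" by blast
        then have z': "(fst z, snd z) \<in> QT T" by simp
        note Pz = parabolic_solution_solves_relaxation_system[OF P z', unfolded prod.collapse]
        show "dt T ?u z - dt T ?ub z + (dx ?v z - dx ?vb z) = 0"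
          using H1[OF z] Pz(1) by simp
        show "eps\<^sup>2 * (dt T ?v z - ?g z) + lam\<^sup>2 * (dx ?u z - dx ?ub z)
            = a * (?u z - ?ub z) - (?v z - ?vb z) - eps\<^sup>2 * ?g z"
          using H2[OF z] Pz(2) by (simp add: algebra_simps)
      qed (intro DERIV_diff C_k_1_derivatives[OF _ \<open>t < T\<close>] continuous_on_diff
          C_k_1_continuous[OF _ \<open>t < T\<close>] C1 C1b; assumption)+
      then show ?thesis
        by (simp add: c_def)
    qed
    also have "\<dots> \<le> eps ^ 4 / 4 * K\<^sup>2"
    proof (intro mult_left_mono integral_square_le_L2_norm[OF L2(1) _ _ _ L2(2)])
      show "continuous_on ({- R..R} \<times> {0..t}) ?g"
        using C_k_1_continuous(2)[OF C1b(2) \<open>t < T\<close>] by (rule continuous_on_subset) auto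
    qed (use strip in \<open>auto intro: compact_Times\<close>)
    finally have "ennreal (?I t) \<le> ennreal (?I 0 + K\<^sup>2 / 4 * eps ^ 4)"
      by (intro ennreal_leI) (simp add: mult.commute)
    also have "\<dots> = ennreal (?I 0) + ennreal (K\<^sup>2 / 4 * eps ^ 4)"
    proof (rule ennreal_plus)
      show "0 \<le> ?I 0"
        using cone_weight_bounds[of c 0 R] \<open>c > 0\<close> \<open>R > 0\<close> e_nonneg \<open>0 \<le> t\<close>
        by (intro integral_nonneg h_int) auto
    qed simp
    also have "ennreal (?I 0) = (\<integral>\<^sup>+ x. ennreal (?h 0 x) \<partial>lborel)"
      using h_nn[of 0] \<open>0 \<le> t\<close> by simp
    also have "\<dots> \<le> phi a lam eps w wb 0"
      unfolding phi_eq_entropy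
      using cone_weight_bounds[of c 0 R] \<open>c > 0\<close> \<open>R > 0\<close> e_nonneg
      by (intro nn_integral_mono ennreal_leI mult_left_le_one_le) auto
    finally show ?thesis
      using h_nn[of t] \<open>0 \<le> t\<close> by (simp add: add_right_mono)
  qed
  \<comment> \<open>Radii \<open>n + 1\<close> rather than \<open>n\<close>, because the weight needs a positive radius.\<close>
  let ?hn = "\<lambda>n x. ennreal (cone_weight c (real (Suc n)) (x, t) * ?e (x, t))"
  have "(\<lambda>n. ?hn n x) \<longlonglongrightarrow> ennreal (1 * ?e (x, t))" for x
    by (intro tendsto_intros filterlim_compose[OF tendsto_cone_weight]
        filterlim_compose[OF filterlim_real_sequentially] filterlim_Suc)
  then have "liminf (\<lambda>n. ?hn n x) = ennreal (?e (x, t))" for x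
    by (intro lim_imp_Liminf) auto
  then have "phi a lam eps w wb t = (\<integral>\<^sup>+ x. liminf (\<lambda>n. ?hn n x) \<partial>lborel)"
    by (simp add: phi_eq_entropy)
  also have "\<dots> \<le> liminf (\<lambda>n. \<integral>\<^sup>+ x. ?hn n x \<partial>lborel)"
  proof (rule nn_integral_liminf)
    fix n show "?hn n \<in> borel_measurable lborel"
      using borel_measurable_continuous_onI[OF h_cont[of t "real (Suc n)"]] \<open>0 \<le> t\<close> by simp
  qed
  also have "\<dots> \<le> phi a lam eps w wb 0 + ennreal (K\<^sup>2 / 4 * eps ^ 4)"
    using cone by (intro Liminf_le always_eventually) auto
  finally show ?thesis .
qed

theorem theorem2p2:
  fixes a lam T K :: real
  assumes "lam > 0" and "T > 0" and "K > 0"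
  shows
    "(\<forall>eps w0 wb0 w wb wm wp.
        relaxation_setting a lam T K eps w0 wb0 w wb wm wp \<longrightarrow>
        (\<forall>t \<in> {0..<T}.
           phi a lam eps w wb t \<le> phi a lam eps w wb 0 + ennreal (K\<^sup>2 / 2 * eps ^ 4))) \<and>
     (\<forall>w0 wb0 w wb wm wp.
        (\<forall>\<^sub>F eps in at_right 0.
           relaxation_setting a lam T K eps (w0 eps) (wb0 eps) (w eps) (wb eps) (wm eps) (wp eps)) \<longrightarrow>
        ((\<lambda>eps. phi a lam eps (w eps) (wb eps) 0) \<longlongrightarrow> 0) (at_right 0) \<longrightarrow>
        ((\<lambda>eps. SUP t \<in> {0..<T}. phi a lam eps (w eps) (wb eps) t) \<longlongrightarrow> 0) (at_right 0))"
proof (intro conjI allI impI ballI)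
  have bound: "phi a lam eps w wb t \<le> phi a lam eps w wb 0 + ennreal (K\<^sup>2 / 2 * eps ^ 4)"
    if "relaxation_setting a lam T K eps w0 wb0 w wb wm wp" and "t \<in> {0..<T}"
    for eps w0 wb0 w wb wm wp t
  proof -
    have "phi a lam eps w wb t \<le> phi a lam eps w wb 0 + ennreal (K\<^sup>2 / 4 * eps ^ 4)"
      using phi_le[OF _ _ that(1)] that(2) by simp
    also have "\<dots> \<le> phi a lam eps w wb 0 + ennreal (K\<^sup>2 / 2 * eps ^ 4)"
      by (intro add_left_mono ennreal_leI mult_right_mono) auto
    finally show ?thesis .
  qed
  show "phi a lam eps w wb t \<le> phi a lam eps w wb 0 + ennreal (K\<^sup>2 / 2 * eps ^ 4)"
    if "relaxation_setting a lam T K eps w0 wb0 w wb wm wp" and "t \<in> {0..<T}"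
    for eps w0 wb0 w wb wm wp t
    using bound that .
  fix w0 wb0 w wb wm wp
  assume setting: "\<forall>\<^sub>F eps in at_right 0.
      relaxation_setting a lam T K eps (w0 eps) (wb0 eps) (w eps) (wb eps) (wm eps) (wp eps)"
    and init: "((\<lambda>eps. phi a lam eps (w eps) (wb eps) 0) \<longlongrightarrow> 0) (at_right 0)"
  show "((\<lambda>eps. SUP t \<in> {0..<T}. phi a lam eps (w eps) (wb eps) t) \<longlongrightarrow> 0) (at_right 0)"
  proof (rule tendsto_sandwich[where f = "\<lambda>_. 0"])
    show "\<forall>\<^sub>F eps in at_right 0. (SUP t \<in> {0..<T}. phi a lam eps (w eps) (wb eps) t)
        \<le> phi a lam eps (w eps) (wb eps) 0 + ennreal (K\<^sup>2 / 2 * eps ^ 4)"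
      using setting by eventually_elim (blast intro: SUP_least bound)
    have "((\<lambda>eps. K\<^sup>2 / 2 * eps ^ 4) \<longlongrightarrow> K\<^sup>2 / 2 * 0 ^ 4) (at_right 0)"
      by (intro tendsto_intros)
    then have "((\<lambda>eps. ennreal (K\<^sup>2 / 2 * eps ^ 4)) \<longlongrightarrow> ennreal 0) (at_right 0)"
      by (intro tendsto_intros) simp
    from tendsto_add[OF init this]
    show "((\<lambda>eps. phi a lam eps (w eps) (wb eps) 0 + ennreal (K\<^sup>2 / 2 * eps ^ 4)) \<longlongrightarrow> 0)
        (at_right 0)"
      by simp
  qed auto
qed

end
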